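(* Let $m$ and $n$ be positive integers, and let $A$ and $B$ be $m\times n$ matrices. Then $$\det\bigl(AU_nB^t+BU_nA^t+AB^t\bigr)=\left(\sum_{1\le i_1\le j_1<i_2\le j_2<\cdots\le n}\det(A^{i_1}B^{j_1}A^{i_2}B^{j_2}\cdots)\right)\left(\sum_{1\le i_1<j_1\le i_2<j_2\le\cdots\le n}\det(B^{i_1}A^{j_1}B^{i_2}A^{j_2}\cdots)\right).$$ Here $A^{i}$ (respectively $B^{i}$) is the $i$-th column of $A$ (respectively $B$), and $A^{i_1}B^{j_1}A^{i_2}B^{j_2}\cdots$ denotes the concatenation of $m$ columns, so that the last column in the concatenation is $B^{j_{m/2}}$ if $m$ is even and $A^{i_{(m+1)/2}}$ if $m$ is odd; analogous conventions apply to the second factor (the last column of $B^{i_1}A^{j_1}B^{i_2}A^{j_2}\cdots$ is $A^{j_{m/2}}$ if $m$ is even and $B^{i_{(m+1)/2}}$ if $m$ is odd). The sums are over all chains of $m$ indices in total, with alternating inequalities as displayed.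
   Context: All matrices have entries in a commutative ring with unit. $U_n$ is the $n\times n$ upper triangular matrix with all entries strictly above the diagonal equal to $1$ and all other entries equal to $0$. Concatenation means placing columns side by side to form an $m\times m$ matrix. In the first sum the index chain is $1\le i_1\le j_1<i_2\le j_2<i_3\le\cdots$ (that is, $i_k\le j_k$ and $j_k<i_{k+1}$), with last index at most $n$; in the second sum it is $1\le i_1<j_1\le i_2<j_2\le i_3<\cdots$ (that is, $i_k<j_k$ and $j_k\le i_{k+1}$), with last index at most $n$. *)

theory Defs
  imports "Jordan_Normal_Form.Determinant"
begin

definition strict_upper_ones :: "nat \<Rightarrow> 'a::comm_ring_1 mat" where
  "strict_upper_ones n = mat n n (\<lambda>(i, j). if i < j then 1 else 0)"

(* A chain i_1, j_1, i_2, j_2, ... is stored as one list of length m, and both list positions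
   and column indices are counted from 0: i_k sits at position 2k - 2, j_k at position 2k - 1,
   and the index bounds 1, ..., n become 0, ..., n - 1. *)

definition weak_strict_chains :: "nat \<Rightarrow> nat \<Rightarrow> nat list set" where
  "weak_strict_chains m n = {c. length c = m \<and> set c \<subseteq> {..<n} \<and>
     (\<forall>k. Suc k < m \<longrightarrow> (if even k then c ! k \<le> c ! Suc k else c ! k < c ! Suc k))}"

definition strict_weak_chains :: "nat \<Rightarrow> nat \<Rightarrow> nat list set" where
  "strict_weak_chains m n = {c. length c = m \<and> set c \<subseteq> {..<n} \<and>
     (\<forall>k. Suc k < m \<longrightarrow> (if even k then c ! k < c ! Suc k else c ! k \<le> c ! Suc k))}"

lemma finite_weak_strict_chains: "finite (weak_strict_chains m n)"
  by (rule finite_subset[OF _ finite_lists_length_eq[of "{..<n}" m]])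
     (auto simp: weak_strict_chains_def)

lemma finite_strict_weak_chains: "finite (strict_weak_chains m n)"
  by (rule finite_subset[OF _ finite_lists_length_eq[of "{..<n}" m]])
     (auto simp: strict_weak_chains_def)

definition alternating_cols :: "'a mat \<Rightarrow> 'a mat \<Rightarrow> nat list \<Rightarrow> 'a mat" where
  "alternating_cols A B c = mat_of_cols (dim_row A)
     (map (\<lambda>k. if even k then col A (c ! k) else col B (c ! k)) [0..<length c])"

end

theory Submission
  imports Defs
begin

text \<open>
Write the columns in the interleaved order \<open>A\<^sup>1, B\<^sup>1, A\<^sup>2, B\<^sup>2, ...\<close> and call them
\<open>v\<^sub>1, v\<^sub>2, ...\<close>, each with its type \<open>A\<close> or \<open>B\<close>. The matrix on the left-hand side is
\<open>Y = \<Sum> v\<^sub>p v\<^sub>q\<^sup>T\<close> over all \<open>p < q\<close> of different types. The index chains of the two sums are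
exactly the subsequences of length \<open>m\<close> whose types alternate, starting with \<open>A\<close> in the first sum
and with \<open>B\<close> in the second. As the length is fixed, one may equally classify them by the last
type. Let \<open>P\<^sub>t\<close> be the sum of \<open>det (v\<^bsub>s\<^esub>)\<close> over the alternating subsequences \<open>s\<close> of length
\<open>m\<close> ending in type \<open>t\<close>. The claim becomes \<open>det Y = P\<^sub>A P\<^sub>B\<close>, for arbitrary sequences of typed
columns (\<open>pair_det_factors\<close>), and it can be proved by adding columns at the end.

Add a column \<open>v\<close> of type \<open>t\<close>. The factor of the other type does not change; \<open>P\<^sub>t\<close> becomes
\<open>P\<^sub>t + \<Sum> v\<^sub>j h\<^sub>j\<close>, where \<open>v\<^sub>j\<close> are here the entries of \<open>v\<close> and \<open>h\<^sub>j\<close> are sums of cofactors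
over alternating subsequences of length \<open>m - 1\<close> ending in the other type; and \<open>Y\<close> becomes
\<open>Y + c v\<^sup>T\<close>, where \<open>c\<close> is the sum of the columns of the other type. The heart of the matter is
the linear relation \<open>Y h = P\<^sub>t c\<close>. It is the case of two equal rows of an identity in the exterior
algebra, \<open>alternating_exchange\<close>, which has a short inductive proof. By a matrix determinant lemma
the relation yields \<open>P\<^sub>t det (Y + c v\<^sup>T) = det Y (P\<^sub>t + \<Sum> v\<^sub>j h\<^sub>j)\<close> (\<open>pair_det_Cons\<close>), so
\<open>det Y = P\<^sub>A P\<^sub>B\<close> passes to the longer sequence, provided that \<open>P\<^sub>t\<close> may be cancelled.

To make it cancellable over every commutative ring \<open>R\<close>, pass to \<open>R[z]\<close> and start the sequence with
the columns of \<open>A = B = z I\<close>. For these columns alone \<open>Y = z\<^sup>2 (I + 2 U\<^sub>m)\<close> and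
\<open>P\<^sub>A = P\<^sub>B = z\<^sup>m\<close>, so the claim holds; and whatever columns follow, \<open>P\<^sub>A\<close> and \<open>P\<^sub>B\<close> are
monic in \<open>z\<close>. At the end, \<open>z = 0\<close> removes the auxiliary columns.
\<close>

section \<open>Typed columns and sums over alternating subsequences\<close>

text \<open>
Columns are functions on row indices, so that the same list of columns can be read as an
\<open>m \<times> m\<close> determinant and, one row further down, as an \<open>(m + 1) \<times> (m + 1)\<close> one.
\<close>

definition col_det :: "nat \<Rightarrow> (nat \<Rightarrow> 'a::comm_ring_1) list \<Rightarrow> 'a" where
  "col_det m vs = det (mat m m (\<lambda>(i, j). (vs ! j) i))"

text \<open>
A typed column list carries the last column at its head. \<open>alt_sum \<Phi> b k cs\<close> is the sum of
\<open>\<Phi> [v\<^sub>1, ..., v\<^sub>k]\<close> over the \<open>k\<close>-element subsequences of the columns, in their order from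
left to right, whose types alternate and end with \<open>b\<close>. Keeping \<open>\<Phi>\<close> abstract lets columns
chosen later be absorbed into \<open>\<Phi>\<close>, which is what makes inductions on the list go through.
\<close>

fun alt_sum :: "('v list \<Rightarrow> 'a::comm_ring_1) \<Rightarrow> bool \<Rightarrow> nat \<Rightarrow> (bool \<times> 'v) list \<Rightarrow> 'a" where
  "alt_sum \<Phi> b 0 cs = \<Phi> []"
| "alt_sum \<Phi> b (Suc k) [] = 0"
| "alt_sum \<Phi> b (Suc k) ((t, v) # cs) = alt_sum \<Phi> b (Suc k) cs +
     (if t = b then alt_sum (\<lambda>vs. \<Phi> (vs @ [v])) (\<not> b) k cs else 0)"

fun type_sum :: "bool \<Rightarrow> (bool \<times> (nat \<Rightarrow> 'a::comm_ring_1)) list \<Rightarrow> nat \<Rightarrow> 'a" where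
  "type_sum b [] i = 0"
| "type_sum b ((t, v) # cs) i = type_sum b cs i + (if t = b then v i else 0)"

text \<open>
The \<open>(i, j)\<close> entry of \<open>\<Sum> v\<^sub>p v\<^sub>q\<^sup>T\<close>, summed over all \<open>p < q\<close> whose columns differ in type.
\<close>

fun pair_form :: "(bool \<times> (nat \<Rightarrow> 'a::comm_ring_1)) list \<Rightarrow> nat \<Rightarrow> nat \<Rightarrow> 'a" where
  "pair_form [] i j = 0"
| "pair_form ((t, v) # cs) i j = pair_form cs i j + type_sum (\<not> t) cs i * v j"

lemma alt_sum_cong:
  assumes "\<And>vs. length vs = k \<Longrightarrow> set vs \<subseteq> snd ` set cs \<Longrightarrow> \<Phi> vs = \<Psi> vs"
  shows "alt_sum \<Phi> b k cs = alt_sum \<Psi> b k cs"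
  using assms
proof (induction \<Phi> b k cs arbitrary: \<Psi> rule: alt_sum.induct)
  case (1 \<Phi> b cs)
  then show ?case by simp
next
  case (2 \<Phi> b k)
  then show ?case by simp
next
  case (3 \<Phi> b k t v cs)
  have "alt_sum \<Phi> b (Suc k) cs = alt_sum \<Psi> b (Suc k) cs"
    by (rule "3.IH"(1), rule "3.prems") auto
  moreover have "alt_sum (\<lambda>vs. \<Phi> (vs @ [v])) (\<not> b) k cs = alt_sum (\<lambda>vs. \<Psi> (vs @ [v])) (\<not> b) k cs"
    if "t = b"
    by (rule "3.IH"(2)[OF that], rule "3.prems") auto
  ultimately show ?case by simp
qed

lemma alt_sum_additive_image:
  assumes "\<And>x y. h (x + y) = h x + h y" and "h 0 = 0"
  shows "h (alt_sum \<Phi> b k cs) = alt_sum (\<lambda>vs. h (\<Phi> vs)) b k cs"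
  by (induction \<Phi> b k cs rule: alt_sum.induct) (auto simp: assms)

lemma alt_sum_add:
  "alt_sum (\<lambda>vs. \<Phi> vs + \<Psi> vs) b k cs = alt_sum \<Phi> b k cs + alt_sum \<Psi> b k cs"
proof (induction \<Phi> b k cs arbitrary: \<Psi> rule: alt_sum.induct)
  case (3 \<Phi> b k t v cs)
  show ?case
  proof (cases "t = b")
    case True
    note eqs = "3.IH"(1) "3.IH"(2)[OF True]
    show ?thesis unfolding alt_sum.simps eqs using True by simp
  next
    case False
    then show ?thesis using "3.IH"(1) by simp
  qed
qed auto

lemma alt_sum_scale: "alt_sum (\<lambda>vs. a * \<Phi> vs) b k cs = a * alt_sum \<Phi> b k cs"
  by (rule alt_sum_additive_image[of "\<lambda>x. a * x", symmetric]) (auto simp: algebra_simps)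

lemma alt_sum_zero [simp]: "alt_sum (\<lambda>vs. 0) b k cs = 0"
  using alt_sum_scale[of 0 "\<lambda>_. 0" b k cs] by simp

lemma alt_sum_sum:
  assumes "finite I"
  shows "alt_sum (\<lambda>vs. \<Sum>i\<in>I. \<Phi> i vs) b k cs = (\<Sum>i\<in>I. alt_sum (\<Phi> i) b k cs)"
  using assms by induction (auto simp: alt_sum_add)

lemma alt_sum_map:
  "alt_sum \<Phi> b k (map (apsnd g) cs) = alt_sum (\<lambda>vs. \<Phi> (map g vs)) b k cs"
proof (induction cs arbitrary: \<Phi> b k)
  case Nil
  then show ?case by (cases k) auto
next
  case (Cons c cs)
  then show ?case by (cases k; cases c) auto
qed

lemma alt_sum_1:
  assumes "\<And>v. \<Phi> [v] = v i * a"
  shows "alt_sum \<Phi> b (Suc 0) cs = type_sum b cs i * a"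
proof (induction cs)
  case (Cons c cs)
  then show ?case by (cases c) (auto simp: assms algebra_simps)
qed auto

text \<open>
Copying row \<open>i\<close> into position \<open>m\<close> specialises the additional linear functional of the exchange
identity below to a coordinate of the columns.
\<close>

definition copy_entry :: "nat \<Rightarrow> nat \<Rightarrow> (nat \<Rightarrow> 'a) \<Rightarrow> nat \<Rightarrow> 'a" where
  "copy_entry i m v = v(m := v i)"

lemma type_sum_copy_entry:
  "type_sum b (map (apsnd (copy_entry i m)) cs) m = type_sum b cs i"
  by (induction cs) (auto simp: copy_entry_def split: prod.splits)

lemma pair_form_copy_entry:
  assumes "j \<noteq> m"
  shows "pair_form (map (apsnd (copy_entry i m)) cs) m j = pair_form cs i j"
proof (induction cs)
  case (Cons c cs)
  then show ?case using assms by (cases c) (simp add: type_sum_copy_entry, simp add: copy_entry_def)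
qed auto

section \<open>Determinants as multilinear functions of their columns\<close>

lemma col_det_cong:
  assumes "\<And>i j. i < m \<Longrightarrow> j < m \<Longrightarrow> (vs ! j) i = (ws ! j) i"
  shows "col_det m vs = col_det m ws"
  unfolding col_det_def using assms by (intro arg_cong[of _ _ det] cong_mat) auto

text \<open>
The cofactors on the right do not involve \<open>x\<close>: this is linearity in one column with explicit
coefficients.
\<close>

lemma col_det_expand:
  fixes vs ws :: "(nat \<Rightarrow> 'a::comm_ring_1) list"
  assumes "length vs + length ws + 1 = m"
  shows "col_det m (vs @ x # ws) =
    (\<Sum>i<m. x i * cofactor (mat m m (\<lambda>(i, j). ((vs @ (\<lambda>_. 0) # ws) ! j) i)) i (length vs))"
proof -
  let ?l = "length vs"
  let ?M = "\<lambda>x. mat m m (\<lambda>(i, j). ((vs @ x # ws) ! j) i)"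
  have l: "?l < m" using assms by simp
  have "mat_delete (?M x) i ?l = mat_delete (?M (\<lambda>_. 0)) i ?l" for i
    unfolding mat_delete_def by (intro cong_mat) (auto simp: nth_append nth_Cons split: nat.splits)
  then have "cofactor (?M x) i ?l = cofactor (?M (\<lambda>_. 0)) i ?l" for i
    unfolding cofactor_def by simp
  moreover have "col_det m (vs @ x # ws) = (\<Sum>i<m. ?M x $$ (i, ?l) * cofactor (?M x) i ?l)"
    unfolding col_det_def by (rule laplace_expansion_column) (use l in auto)
  ultimately show ?thesis using l by (auto intro!: sum.cong)
qed

lemma col_det_linear:
  fixes x y :: "nat \<Rightarrow> 'a::comm_ring_1"
  assumes "length vs + length ws + 1 = m"
  shows "col_det m (vs @ (\<lambda>i. x i + a * y i) # ws)
       = col_det m (vs @ x # ws) + a * col_det m (vs @ y # ws)"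
  unfolding col_det_expand[OF assms]
  by (simp add: sum_distrib_left sum.distrib algebra_simps)

lemma col_det_not_distinct:
  assumes "length vs = m" and "\<not> distinct vs"
  shows "col_det m vs = 0"
proof -
  obtain i j where "i < m" "j < m" "i \<noteq> j" "vs ! i = vs ! j"
    using assms distinct_conv_nth by metis
  then show ?thesis
    unfolding col_det_def by (intro det_identical_columns[of _ m i j]) auto
qed

lemma col_det_swap:
  fixes x y :: "nat \<Rightarrow> 'a::comm_ring_1"
  assumes "length vs + length ws + 2 = m"
  shows "col_det m (vs @ x # y # ws) = - col_det m (vs @ y # x # ws)"
proof -
  let ?D = "\<lambda>u v. col_det m (vs @ u # v # ws)"
  have left: "?D (\<lambda>i. u i + u' i) v = ?D u v + ?D u' v" for u u' v
    using col_det_linear[of vs "v # ws" m u 1 u'] assms by simp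
  have right: "?D u (\<lambda>i. v i + v' i) = ?D u v + ?D u v'" for u v v'
    using col_det_linear[of "vs @ [u]" ws m v 1 v'] assms by simp
  have same: "?D u u = 0" for u
    by (rule col_det_not_distinct) (use assms in auto)
  have "0 = ?D (\<lambda>i. x i + y i) (\<lambda>i. x i + y i)" by (simp only: same)
  also have "\<dots> = ?D x y + ?D y x" by (simp add: left right same)
  finally show ?thesis by (simp add: eq_neg_iff_add_eq_0)
qed

lemma col_det_unit_last:
  fixes vs ws :: "(nat \<Rightarrow> 'a::comm_ring_1) list"
  assumes "length vs + length ws = m"
  shows "col_det (Suc m) (vs @ (\<lambda>i. if i = m then 1 else 0) # ws) = (- 1) ^ length ws * col_det m (vs @ ws)"
proof -
  let ?e = "\<lambda>i. if i = m then 1 else (0::'a)"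
  let ?M = "mat (Suc m) (Suc m) (\<lambda>(i, j). ((vs @ (\<lambda>_. 0) # ws) ! j) i)"
  have "mat_delete ?M m (length vs) = mat m m (\<lambda>(i, j). ((vs @ ws) ! j) i)"
    unfolding mat_delete_def
    by (rule eq_matI) (use assms in \<open>auto simp: nth_append nth_Cons Suc_diff_le split: nat.splits\<close>)
  moreover have "(-1 :: 'a) ^ (m + length vs) = (-1) ^ length ws"
    unfolding assms[symmetric] by (simp add: power_add mult.commute[of _ "(-1) ^ length ws"] mult.assoc flip: power_mult_distrib)
  ultimately have "cofactor ?M m (length vs) = (- 1) ^ length ws * col_det m (vs @ ws)"
    unfolding cofactor_def col_det_def by simp
  then show ?thesis
    using col_det_expand[of vs ws "Suc m" ?e] assms by (simp add: sum.delta' if_distrib[of "\<lambda>a. a * _"] cong: if_cong)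
qed

lemma col_det_last_row_zero:
  assumes "length vs = Suc m" and "\<forall>v\<in>set vs. v m = 0"
  shows "col_det (Suc m) vs = 0"
proof -
  let ?M = "mat (Suc m) (Suc m) (\<lambda>(i, j). (vs ! j) i)"
  have "col_det (Suc m) vs = (\<Sum>j<Suc m. ?M $$ (m, j) * cofactor ?M m j)"
    unfolding col_det_def by (rule laplace_expansion_row) auto
  also have "\<dots> = 0"
  proof (intro sum.neutral ballI)
    fix j assume "j \<in> {..<Suc m}"
    then show "?M $$ (m, j) * cofactor ?M m j = 0"
      using assms by (metis (no_types, lifting) index_mat(1) lessI lessThan_iff mult_zero_left nth_mem prod.case)
  qed
  finally show ?thesis .
qed


section \<open>The exchange identity\<close>

text \<open>
In the exterior algebra, let \<open>S\<^sub>k\<^sup>b\<close> be the sum of the products \<open>v\<^sub>1 \<and> ... \<and> v\<^sub>k\<close> over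
the alternating subsequences ending in type \<open>b\<close>, let \<open>\<rho>\<close> be the linear functional that reads
off entry \<open>m\<close>, and let \<open>D\<close> be the antiderivation (contraction) determined by \<open>\<rho>\<close>. With
\<open>y = \<Sum> \<rho>(v\<^sub>p) v\<^sub>q\<close> over \<open>p < q\<close> of different types, and \<open>r\<^sup>b\<close> the sum of \<open>\<rho>(v\<^sub>p)\<close>
over the columns of type \<open>b\<close>, the identity says, for \<open>c\<close> the type other than \<open>b\<close>,

\<open>S\<^sub>k\<^sup>b \<and> y - r\<^sup>b S\<^sub>k\<^sub>+\<^sub>1\<^sup>c = (-1)\<^sup>k D S\<^sub>k\<^sub>+\<^sub>2\<^sup>b\<close>.

The columns \<open>ds\<close> fill this up to top degree, and \<open>D\<close> becomes a determinant with \<open>\<rho>\<close> as an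
extra last row; \<open>D\<close> must not act on \<open>ds\<close>, hence the zeros required there.

It is proved by adding one column \<open>v\<close> at a time. If the type of \<open>v\<close> is not \<open>b\<close>, then both terms
on the left grow by \<open>r\<^sup>b S\<^sub>k\<^sup>b \<and> v\<close> and the right-hand side does not change. If it is \<open>b\<close>, then
\<open>S\<^sub>k\<^sub>+\<^sub>2\<^sup>b\<close> grows by \<open>S\<^sub>k\<^sub>+\<^sub>1\<^sup>c \<and> v\<close>; by the Leibniz rule, \<open>D\<close> of this consists, up
to signs, of \<open>D S\<^sub>k\<^sub>+\<^sub>1\<^sup>c \<and> v\<close>, which by the identity for \<open>c\<close> one degree lower is the growth
of the first term on the left, and of \<open>\<rho>(v) S\<^sub>k\<^sub>+\<^sub>1\<^sup>c\<close>, which is the growth of the second.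
\<close>

lemma alternating_exchange:
  fixes cs :: "(bool \<times> (nat \<Rightarrow> 'a::comm_ring_1)) list"
  assumes "Suc k + length ds = m" and "\<forall>d\<in>set ds. d m = 0"
  shows "alt_sum (\<lambda>vs. col_det m (vs @ pair_form cs m # ds)) b k cs
       - type_sum b cs m * alt_sum (\<lambda>vs. col_det m (vs @ ds)) (\<not> b) (Suc k) cs
       = - ((- 1) ^ length ds * alt_sum (\<lambda>vs. col_det (Suc m) (vs @ ds)) b (Suc (Suc k)) cs)"
  using assms
proof (induction cs arbitrary: b k ds)
  case Nil
  have "col_det m ((\<lambda>_. 0) # ds) = 0" if "k = 0"
    using col_det_expand[of "[]" ds m "\<lambda>_. 0"] Nil that by simp
  then show ?case by (cases k) (auto simp: fun_eq_iff)
next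
  case (Cons c cs)
  obtain t v where c: "c = (t, v)" by (cases c)
  let ?l = "length ds"
  let ?y = "pair_form cs m"
  let ?y' = "\<lambda>j. pair_form cs m j + type_sum (\<not> t) cs m * v j"
  have y': "pair_form (c # cs) m = ?y'" by (simp add: c fun_eq_iff)
  have split_y': "col_det m (vs @ ?y' # ds) = col_det m (vs @ ?y # ds)
      + type_sum (\<not> t) cs m * col_det m (vs @ v # ds)" if "length vs = k" for vs
    by (rule col_det_linear) (use that Cons.prems in auto)
  show ?case
  proof (cases "t = b")
    case False
    then have t: "t = (\<not> b)" by auto
    have "alt_sum (\<lambda>vs. col_det m (vs @ ?y' # ds)) b k cs
        = alt_sum (\<lambda>vs. col_det m (vs @ ?y # ds) + type_sum b cs m * col_det m (vs @ v # ds)) b k cs"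
      by (rule alt_sum_cong) (use split_y' t in simp)
    then have "alt_sum (\<lambda>vs. col_det m (vs @ ?y' # ds)) b k cs
        = alt_sum (\<lambda>vs. col_det m (vs @ ?y # ds)) b k cs
        + type_sum b cs m * alt_sum (\<lambda>vs. col_det m (vs @ v # ds)) b k cs"
      by (simp add: alt_sum_add alt_sum_scale)
    moreover have "alt_sum \<Phi> b k (c # cs) = alt_sum \<Phi> b k cs" for \<Phi> :: "(nat \<Rightarrow> 'a) list \<Rightarrow> 'a"
      using t by (cases k) (auto simp: c)
    ultimately show ?thesis
      unfolding y' using Cons.IH[OF Cons.prems, of b] t by (simp add: c algebra_simps)
  next
    case True
    \<comment> \<open>Splitting off the entry read by \<open>\<rho>\<close> separates the two terms of the Leibniz rule.\<close>
    define v0 where "v0 = v(m := 0)"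
    define e where "e = (\<lambda>i. if i = m then 1 else (0::'a))"
    have v: "v = (\<lambda>i. v0 i + v m * e i)" by (auto simp: v0_def e_def)
    have v0m: "\<forall>d\<in>set (v0 # ds). d m = 0" using Cons.prems by (simp add: v0_def)
    have v0: "col_det m (us @ v # ws) = col_det m (us @ v0 # ws)" for us ws
      by (rule col_det_cong) (auto simp: v0_def nth_append nth_Cons split: nat.splits)
    have right: "alt_sum (\<lambda>vs. col_det (Suc m) (vs @ v # ds)) (\<not> b) (Suc k) cs
       = alt_sum (\<lambda>vs. col_det (Suc m) (vs @ v0 # ds)) (\<not> b) (Suc k) cs
       + v m * ((-1) ^ ?l * alt_sum (\<lambda>vs. col_det m (vs @ ds)) (\<not> b) (Suc k) cs)"
    proof -
      have "col_det (Suc m) (vs @ v # ds) = col_det (Suc m) (vs @ v0 # ds)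
          + v m * ((-1) ^ ?l * col_det m (vs @ ds))" if "length vs = Suc k" for vs
      proof -
        have "col_det (Suc m) (vs @ v # ds)
            = col_det (Suc m) (vs @ v0 # ds) + v m * col_det (Suc m) (vs @ e # ds)"
          by (subst v, rule col_det_linear) (use that Cons.prems in auto)
        also have "col_det (Suc m) (vs @ e # ds) = (-1) ^ ?l * col_det m (vs @ ds)"
          unfolding e_def by (rule col_det_unit_last) (use that Cons.prems in auto)
        finally show ?thesis .
      qed
      then have "alt_sum (\<lambda>vs. col_det (Suc m) (vs @ v # ds)) (\<not> b) (Suc k) cs
        = alt_sum (\<lambda>vs. col_det (Suc m) (vs @ v0 # ds)
          + v m * ((-1) ^ ?l * col_det m (vs @ ds))) (\<not> b) (Suc k) cs"
        by (intro alt_sum_cong) auto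
      then show ?thesis by (simp add: alt_sum_add alt_sum_scale)
    qed
    have sq: "(-1) ^ ?l * ((-1) ^ ?l * x) = (x::'a)" for x
      by (simp add: mult.assoc[symmetric] flip: power_mult_distrib)
    \<comment> \<open>For \<open>k = 0\<close> the identity one degree lower would have \<open>k = -1\<close>; it is checked directly.\<close>
    have left: "alt_sum (\<lambda>vs. col_det m (vs @ ?y' # ds)) b k (c # cs)
       = alt_sum (\<lambda>vs. col_det m (vs @ ?y # ds)) b k cs
       - (-1) ^ ?l * alt_sum (\<lambda>vs. col_det (Suc m) (vs @ v0 # ds)) (\<not> b) (Suc k) cs"
    proof (cases k)
      case 0
      have "alt_sum (\<lambda>vs. col_det (Suc m) (vs @ v0 # ds)) (\<not> b) (Suc 0) cs
          = type_sum (\<not> b) cs m * ((-1) ^ Suc ?l * col_det m (v0 # ds))"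
      proof (rule alt_sum_1)
        fix x :: "nat \<Rightarrow> 'a"
        have x: "x = (\<lambda>i. (x(m := 0)) i + x m * e i)" by (auto simp: e_def)
        have "col_det (Suc m) ([] @ x # v0 # ds)
            = col_det (Suc m) ([] @ x(m := 0) # v0 # ds) + x m * col_det (Suc m) ([] @ e # v0 # ds)"
          by (subst x, rule col_det_linear) (use 0 Cons.prems in auto)
        also have "col_det (Suc m) ([] @ x(m := 0) # v0 # ds) = 0"
          by (rule col_det_last_row_zero) (use 0 Cons.prems v0m in auto)
        also have "col_det (Suc m) ([] @ e # v0 # ds) = (-1) ^ Suc ?l * col_det m (v0 # ds)"
          unfolding e_def by (subst col_det_unit_last) (use 0 Cons.prems in auto)
        finally show "col_det (Suc m) ([x] @ v0 # ds) = x m * ((-1) ^ Suc ?l * col_det m (v0 # ds))"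
          by simp
      qed
      moreover have "(-1) ^ ?l * (a * ((-1) ^ Suc ?l * x)) = - (a * x)" for a x :: 'a
        using sq[of "a * x"] by (simp add: mult.left_commute)
      ultimately show ?thesis
        using 0 True split_y'[of "[]"] v0[of "[]" ds] by simp
    next
      case (Suc k')
      let ?Y = "\<lambda>vs. col_det m (vs @ ?y # v0 # ds)"
      have "alt_sum (\<lambda>vs. col_det m (vs @ v # ?y' # ds)) (\<not> b) k' cs
          = alt_sum (\<lambda>vs. (-1) * ?Y vs) (\<not> b) k' cs"
      proof (rule alt_sum_cong)
        fix vs :: "(nat \<Rightarrow> 'a) list"
        assume len: "length vs = k'"
        have "col_det m (vs @ v # ?y' # ds) = - col_det m (vs @ ?y' # v # ds)"
          by (rule col_det_swap) (use len Suc Cons.prems in auto)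
        also have "col_det m (vs @ ?y' # v # ds) = col_det m (vs @ ?y # v # ds)
             + type_sum (\<not> t) cs m * col_det m (vs @ v # v # ds)"
          by (rule col_det_linear) (use len Suc Cons.prems in auto)
        also have "col_det m (vs @ v # v # ds) = 0"
          by (rule col_det_not_distinct) (use len Suc Cons.prems in auto)
        also have "col_det m (vs @ ?y # v # ds) = ?Y vs"
          using v0[of "vs @ [?y]" ds] by simp
        finally show "col_det m (vs @ v # ?y' # ds) = (-1) * ?Y vs" by simp
      qed
      moreover have "alt_sum (\<lambda>vs. col_det m (vs @ ?y' # ds)) b k cs
          = alt_sum (\<lambda>vs. col_det m (vs @ ?y # ds)) b k cs
          + type_sum (\<not> b) cs m * alt_sum (\<lambda>vs. col_det m (vs @ v0 # ds)) b k cs"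
      proof -
        have "alt_sum (\<lambda>vs. col_det m (vs @ ?y' # ds)) b k cs
          = alt_sum (\<lambda>vs. col_det m (vs @ ?y # ds) + type_sum (\<not> b) cs m * col_det m (vs @ v0 # ds)) b k cs"
          by (rule alt_sum_cong) (use split_y' True v0 in simp)
        then show ?thesis by (simp add: alt_sum_add alt_sum_scale)
      qed
      moreover have "alt_sum ?Y (\<not> b) k' cs
          - type_sum (\<not> b) cs m * alt_sum (\<lambda>vs. col_det m (vs @ v0 # ds)) b k cs
          = (-1) ^ ?l * alt_sum (\<lambda>vs. col_det (Suc m) (vs @ v0 # ds)) (\<not> b) (Suc k) cs"
        using Cons.IH[of k' "v0 # ds" "\<not> b"] Cons.prems v0m Suc by simp
      ultimately show ?thesis
        using True by (simp add: c Suc alt_sum_scale[of "-1", simplified] algebra_simps)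
    qed
    show ?thesis
      unfolding y' left using Cons.IH[OF Cons.prems, of b] right True
      by (simp add: c algebra_simps sq)
  qed
qed

section \<open>Adding one column\<close>

text \<open>
When \<open>\<rho>\<close> is the \<open>i\<close>-th coordinate, the bordered determinants of the exchange identity have two
equal rows and vanish. Expanding the left-hand side along its last column turns what remains into
a system of linear equations: the matrix \<open>pair_form cs\<close>, applied to the cofactor sums, gives a
multiple of \<open>type_sum b cs\<close>.
\<close>

lemma exchange_along_row:
  assumes "m = Suc k" and "i < m"
  shows "alt_sum (\<lambda>vs. col_det m (vs @ [pair_form cs i])) b k cs
       = type_sum b cs i * alt_sum (col_det m) (\<not> b) m cs"
proof -
  let ?g = "copy_entry i m"
  let ?cs = "map (apsnd ?g) cs"
  have copy: "col_det m (map ?g vs @ ws) = col_det m (vs @ ws)" if "length vs + length ws = m" for vs ws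
    by (rule col_det_cong) (auto simp: copy_entry_def nth_append)
  have "col_det (Suc m) (map ?g vs) = 0" if "length vs = Suc m" for vs
    unfolding col_det_def
    by (rule det_identical_rows[of _ "Suc m" i m]) (use that assms in \<open>auto simp: copy_entry_def row_def\<close>)
  then have "alt_sum (\<lambda>vs. col_det (Suc m) (map ?g vs)) b (Suc m) cs = alt_sum (\<lambda>_. 0) b (Suc m) cs"
    by (intro alt_sum_cong) auto
  then have "alt_sum (col_det (Suc m)) b (Suc m) ?cs = 0"
    by (simp add: alt_sum_map)
  then have "alt_sum (\<lambda>vs. col_det m (vs @ [pair_form ?cs m])) b k ?cs
       = type_sum b ?cs m * alt_sum (col_det m) (\<not> b) m ?cs"
    using alternating_exchange[of k "[]" m ?cs b] assms(1) by (simp add: eq_diff_eq)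
  moreover have "alt_sum (col_det m) (\<not> b) m ?cs = alt_sum (col_det m) (\<not> b) m cs"
    unfolding alt_sum_map by (rule alt_sum_cong) (use copy[of _ "[]"] in simp)
  moreover have "alt_sum (\<lambda>vs. col_det m (vs @ [pair_form ?cs m])) b k ?cs
      = alt_sum (\<lambda>vs. col_det m (vs @ [pair_form cs i])) b k cs"
    unfolding alt_sum_map
    by (intro alt_sum_cong col_det_cong)
      (use assms in \<open>auto simp: nth_append copy_entry_def pair_form_copy_entry less_Suc_eq\<close>)
  ultimately show ?thesis by (simp add: type_sum_copy_entry)
qed

text \<open>
A matrix determinant lemma that needs no inverse of \<open>Y\<close>: given a solution of \<open>Y h = p c\<close>, the
determinant of the bordered matrix with blocks \<open>Y\<close>, \<open>c\<close>, \<open>-v\<^sup>T\<close>, \<open>1\<close> is computed by clearing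
\<open>c\<close> in two ways, once with the corner entry \<open>1\<close> and once with \<open>h\<close>.
\<close>

lemma det_rank_one_update:
  fixes Y :: "'a::comm_ring_1 mat"
  assumes Y: "Y \<in> carrier_mat m m"
    and solution: "\<And>i. i < m \<Longrightarrow> (\<Sum>j<m. Y $$ (i, j) * h j) = c i * p"
  shows "p * det (mat m m (\<lambda>(i, j). Y $$ (i, j) + c i * v j)) = det Y * (p + (\<Sum>j<m. v j * h j))"
proof -
  define C where "C = mat m 1 (\<lambda>(i, _). c i)"
  define V where "V = mat 1 m (\<lambda>(_, j). - v j)"
  define H where "H = mat m 1 (\<lambda>(i, _). - h i)"
  have car: "C \<in> carrier_mat m 1" "V \<in> carrier_mat 1 m" "H \<in> carrier_mat m 1"
    by (auto simp: C_def V_def H_def)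
  define \<Delta> where "\<Delta> = four_block_mat Y C V (1\<^sub>m 1)"
  have \<Delta>: "\<Delta> \<in> carrier_mat (m + 1) (m + 1)"
    unfolding \<Delta>_def using Y car by auto
  have triangular: "det (four_block_mat (1\<^sub>m m) X (0\<^sub>m 1 m) (mat 1 1 (\<lambda>_. q))) = q"
    and triangular_carrier: "four_block_mat (1\<^sub>m m) X (0\<^sub>m 1 m) (mat 1 1 (\<lambda>_. q)) \<in> carrier_mat (m + 1) (m + 1)"
    if X: "X \<in> carrier_mat m 1" for X :: "'a mat" and q
  proof -
    let ?T = "four_block_mat (1\<^sub>m m) X (0\<^sub>m 1 m) (mat 1 1 (\<lambda>_. q))"
    show T: "?T \<in> carrier_mat (m + 1) (m + 1)" using X by auto
    have "det ?T = prod_list (diag_mat ?T)"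
      by (rule det_upper_triangular[OF _ T]) (use X in \<open>auto simp: upper_triangular_def\<close>)
    also have "\<dots> = q"
      using X by (simp add: prod_list_diag_prod)
    finally show "det ?T = q" .
  qed
  have one: "1\<^sub>m 1 = mat 1 1 (\<lambda>_. 1::'a)" by (rule eq_matI) auto
  let ?Z = "mat m m (\<lambda>(i, j). Y $$ (i, j) + c i * v j)"
  let ?s = "p + (\<Sum>j<m. v j * h j)"
  have "det \<Delta> = det ?Z"
  proof -
    let ?T = "four_block_mat (1\<^sub>m m) (- C) (0\<^sub>m 1 m) (mat 1 1 (\<lambda>_. 1))"
    have "?T * \<Delta> = four_block_mat ?Z (0\<^sub>m m 1) V (1\<^sub>m 1)"
      unfolding \<Delta>_def
      by (subst mult_four_block_mat[of _ m m _ 1 _ 1 _ _ m _ 1])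
        (use Y car in \<open>auto simp: one[symmetric] C_def V_def scalar_prod_def intro!: cong_four_block_mat eq_matI\<close>)
    then have "det (?T * \<Delta>) = det ?Z * det (1\<^sub>m 1 :: 'a mat)"
      using det_four_block_mat_upper_right_zero_col[of ?Z m "0\<^sub>m m 1" V "1\<^sub>m 1"] car by simp
    moreover have "det (?T * \<Delta>) = det \<Delta>"
      using det_mult[OF triangular_carrier \<Delta>, of "- C" 1] triangular[of "- C" 1] car by simp
    ultimately show ?thesis by simp
  qed
  moreover have "det \<Delta> * p = det Y * ?s"
  proof -
    let ?T = "four_block_mat (1\<^sub>m m) H (0\<^sub>m 1 m) (mat 1 1 (\<lambda>_. p))"
    have "\<Delta> * ?T = four_block_mat Y (0\<^sub>m m 1) V (mat 1 1 (\<lambda>_. ?s))"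
    proof -
      have "Y * H + C * mat 1 1 (\<lambda>_. p) = 0\<^sub>m m 1"
        by (rule eq_matI)
          (use Y solution in \<open>auto simp: C_def H_def scalar_prod_def sum_negf atLeast0LessThan\<close>)
      moreover have "V * H + 1\<^sub>m 1 * mat 1 1 (\<lambda>_. p) = mat 1 1 (\<lambda>_. ?s)"
        by (rule eq_matI) (auto simp: V_def H_def scalar_prod_def atLeast0LessThan)
      ultimately show ?thesis
        unfolding \<Delta>_def using Y car
        by (subst mult_four_block_mat[of _ m m _ 1 _ 1 _ _ m _ 1]) auto
    qed
    then have "det (\<Delta> * ?T) = det Y * det (mat 1 1 (\<lambda>_. ?s))"
      using det_four_block_mat_upper_right_zero_col[of Y m "0\<^sub>m m 1" V "mat 1 1 (\<lambda>_. ?s)"] Y car by simp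
    moreover have "det (\<Delta> * ?T) = det \<Delta> * p"
      using det_mult[OF \<Delta> triangular_carrier, of H p] triangular[of H p] car by simp
    ultimately show ?thesis by (simp add: det_single)
  qed
  ultimately show ?thesis by (simp add: mult.commute)
qed

definition pair_det :: "nat \<Rightarrow> (bool \<times> (nat \<Rightarrow> 'a::comm_ring_1)) list \<Rightarrow> 'a" where
  "pair_det m cs = det (mat m m (\<lambda>(i, j). pair_form cs i j))"

text \<open>
A new column \<open>v\<close> of type \<open>t\<close> changes the matrix by the rank one term \<open>c v\<^sup>T\<close>, where \<open>c\<close> is the
sum of the columns of the other type. So the determinant and the alternating sum ending in \<open>t\<close>
change in the same proportion.
\<close>

lemma pair_det_Cons:
  assumes "m > 0"
  shows "alt_sum (col_det m) t m cs * pair_det m ((t, v) # cs)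
       = pair_det m cs * alt_sum (col_det m) t m ((t, v) # cs)"
proof -
  obtain k where m: "m = Suc k" using assms by (cases m) auto
  define cof where "cof i vs = cofactor (mat m m (\<lambda>(i, j). ((vs @ [\<lambda>_. 0::'a]) ! j) i)) i k" for i vs
  define h where "h i = alt_sum (cof i) (\<not> t) k cs" for i
  have append: "alt_sum (\<lambda>vs. col_det m (vs @ [x])) (\<not> t) k cs = (\<Sum>i<m. x i * h i)" for x
  proof -
    have "alt_sum (\<lambda>vs. col_det m (vs @ [x])) (\<not> t) k cs
        = alt_sum (\<lambda>vs. \<Sum>i<m. x i * cof i vs) (\<not> t) k cs"
      unfolding cof_def by (rule alt_sum_cong) (use col_det_expand[of _ "[]" m x] m in simp)
    then show ?thesis by (simp add: alt_sum_sum alt_sum_scale h_def)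
  qed
  let ?Y = "mat m m (\<lambda>(i, j). pair_form cs i j)"
  have "(\<Sum>j<m. ?Y $$ (i, j) * h j) = type_sum (\<not> t) cs i * alt_sum (col_det m) t m cs"
    if "i < m" for i
    using exchange_along_row[OF m that, of cs "\<not> t"] that by (simp add: append)
  \<comment> \<open>\<open>h\<close> solves the linear system with right-hand side the multiple \<open>alt_sum (col_det m) t m cs\<close>
    of \<open>c\<close>, as the rank one update requires.\<close>
  from det_rank_one_update[OF _ this, of v]
  have "alt_sum (col_det m) t m cs * det (mat m m (\<lambda>(i, j). ?Y $$ (i, j) + type_sum (\<not> t) cs i * v j))
      = det ?Y * (alt_sum (col_det m) t m cs + (\<Sum>j<m. v j * h j))" by simp
  also have "mat m m (\<lambda>(i, j). ?Y $$ (i, j) + type_sum (\<not> t) cs i * v j)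
      = mat m m (\<lambda>(i, j). pair_form ((t, v) # cs) i j)"
    by (rule cong_mat) auto
  finally show ?thesis
    unfolding pair_det_def by (simp add: m append[unfolded m] del: pair_form.simps sum.lessThan_Suc)
qed

text \<open>
Only the factor that ends in the type of the new column changes; the other one is left as it is.
\<close>

lemma pair_det_factors_Cons:
  assumes "m > 0"
    and "\<And>x y. alt_sum (col_det m) t m cs * x = alt_sum (col_det m) t m cs * y \<Longrightarrow> x = y"
    and "pair_det m cs = alt_sum (col_det m) True m cs * alt_sum (col_det m) False m cs"
  shows "pair_det m ((t, v) # cs)
    = alt_sum (col_det m) True m ((t, v) # cs) * alt_sum (col_det m) False m ((t, v) # cs)"
proof (rule assms(2))
  have "alt_sum (col_det m) (\<not> t) m ((t, v) # cs) = alt_sum (col_det m) (\<not> t) m cs"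
    using assms(1) by (cases m) auto
  moreover have "alt_sum (col_det m) True m ds * alt_sum (col_det m) False m ds
      = alt_sum (col_det m) t m ds * alt_sum (col_det m) (\<not> t) m ds" for ds :: "(bool \<times> (nat \<Rightarrow> 'a)) list"
    by (cases t) (auto simp: mult.commute)
  ultimately show "alt_sum (col_det m) t m cs * pair_det m ((t, v) # cs)
     = alt_sum (col_det m) t m cs
       * (alt_sum (col_det m) True m ((t, v) # cs) * alt_sum (col_det m) False m ((t, v) # cs))"
    using pair_det_Cons[OF assms(1), of t cs v] assms(3) by (simp add: ac_simps)
qed

section \<open>The scalar case\<close>

text \<open>
The columns of \<open>A = B = s I\<close>. The matrix of the theorem is then triangular, and only the
subsequence that uses every index once contributes to an alternating sum, which makes this the
starting point of the induction.
\<close>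

definition unit_col :: "'a::comm_ring_1 \<Rightarrow> nat \<Rightarrow> nat \<Rightarrow> 'a" where
  "unit_col s j i = (if i = j then s else 0)"

fun unit_cols :: "'a::comm_ring_1 \<Rightarrow> nat \<Rightarrow> (bool \<times> (nat \<Rightarrow> 'a)) list" where
  "unit_cols s 0 = []"
| "unit_cols s (Suc j) = (False, unit_col s j) # (True, unit_col s j) # unit_cols s j"

lemma unit_cols_image: "snd ` set (unit_cols s j) = unit_col s ` {..<j}"
  by (induction j) (auto simp: lessThan_Suc)

lemma alt_sum_few_columns:
  assumes "card (snd ` set cs) < k" and "k + length ds = m"
  shows "alt_sum (\<lambda>vs. col_det m (vs @ ds)) b k cs = 0"
proof -
  have "col_det m (vs @ ds) = 0" if "length vs = k" "set vs \<subseteq> snd ` set cs" for vs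
  proof (rule col_det_not_distinct)
    have "card (set vs) < length vs"
      using that assms(1) card_mono[of "snd ` set cs" "set vs"] by simp
    then show "\<not> distinct (vs @ ds)" using distinct_card[of vs] by auto
  qed (use that assms in simp)
  then have "alt_sum (\<lambda>vs. col_det m (vs @ ds)) b k cs = alt_sum (\<lambda>_. 0) b k cs"
    by (intro alt_sum_cong) auto
  then show ?thesis by simp
qed

lemma alt_sum_unit_cols:
  assumes "j \<le> m"
  shows "alt_sum (\<lambda>vs. col_det m (vs @ map (unit_col s) [j..<m])) b j (unit_cols s j) = s ^ m"
  using assms
proof (induction j arbitrary: b)
  case 0
  have "col_det m (map (unit_col s) [0..<m]) = det (s \<cdot>\<^sub>m 1\<^sub>m m)"
    unfolding col_det_def
    by (intro arg_cong[of _ _ det] eq_matI) (auto simp: unit_col_def)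
  then show ?case by simp
next
  case (Suc j)
  let ?u = "unit_col s j" and ?E = "unit_cols s j"
  let ?ds = "map (unit_col s) [Suc j..<m]"
  let ?\<Phi> = "\<lambda>vs. col_det m (vs @ ?ds)" and ?\<Psi> = "\<lambda>vs. col_det m (vs @ ?u # ?ds)"
  have "card (snd ` set ?E) < Suc j"
    unfolding unit_cols_image using card_image_le[of "{..<j}" "unit_col s"] by simp
  \<comment> \<open>A nonzero determinant needs \<open>Suc j\<close> different columns, so one of the two new ones must be used,
    but not both.\<close>
  then have too_few: "alt_sum ?\<Phi> c (Suc j) ?E = 0" for c
    by (rule alt_sum_few_columns) (use Suc.prems in simp)
  have step: "alt_sum ?\<Psi> c j ?E = s ^ m" for c
    using Suc.IH[of c] Suc.prems by (simp add: upt_conv_Cons)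
  have "alt_sum ?\<Psi> c j ((t, ?u) # ?E) = s ^ m" for c t
  proof (cases j)
    case 0
    then show ?thesis using step[of c] by simp
  next
    case (Suc j')
    have "col_det m (vs @ ?u # ?u # ?ds) = 0" if "length vs = j'" for vs
      by (rule col_det_not_distinct) (use that Suc Suc.prems in auto)
    then have "alt_sum (\<lambda>vs. col_det m (vs @ ?u # ?u # ?ds)) d j' ?E = alt_sum (\<lambda>_. 0) d j' ?E" for d
      by (intro alt_sum_cong) auto
    then show ?thesis using step[of c] Suc by simp
  qed
  then show ?case using too_few step by simp
qed

corollary alt_sum_unit_cols_full: "alt_sum (col_det m) b m (unit_cols s m) = s ^ m"
  using alt_sum_unit_cols[of m m s b] by simp

lemma type_sum_unit_cols: "type_sum b (unit_cols s k) i = (if i < k then s else 0)"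
  by (induction k) (auto simp: unit_col_def)

lemma pair_form_unit_cols:
  "pair_form (unit_cols s k) i j =
    (if j < k then if i = j then s * s else if i < j then 2 * (s * s) else 0 else 0)"
  by (induction k) (auto simp: type_sum_unit_cols unit_col_def algebra_simps)

lemma pair_det_unit_cols: "pair_det m (unit_cols s m) = s ^ m * s ^ m"
proof -
  let ?M = "mat m m (\<lambda>(i, j). pair_form (unit_cols s m) i j)"
  have "det ?M = prod_list (diag_mat ?M)"
    by (rule det_upper_triangular[of _ m]) (auto simp: upper_triangular_def pair_form_unit_cols)
  also have "\<dots> = (s * s) ^ m" by (simp add: prod_list_diag_prod pair_form_unit_cols)
  finally show ?thesis by (simp add: pair_det_def power_mult_distrib)
qed

section \<open>Cancellation in a polynomial ring\<close>

text \<open>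
The degree bound is what carries the induction for the coefficient.
\<close>

lemma coeff_prod_linear:
  assumes "finite I" and "\<And>i. i \<in> I \<Longrightarrow> degree (f i) \<le> 1"
  shows "degree (prod f I) \<le> card I \<and> coeff (prod f I) (card I) = (\<Prod>i\<in>I. coeff (f i) 1)"
  using assms
proof (induction I)
  case (insert i I)
  let ?n = "card I"
  have IH: "degree (prod f I) \<le> ?n" "coeff (prod f I) ?n = (\<Prod>i\<in>I. coeff (f i) 1)"
    and deg: "degree (f i) \<le> 1"
    using insert by auto
  have "coeff (f i * prod f I) (1 + ?n)
      = (\<Sum>j\<le>1 + ?n. if j = 1 then coeff (f i) 1 * coeff (prod f I) ?n else 0)"
    unfolding coeff_mult
  proof (rule sum.cong)
    fix j assume "j \<in> {..1 + ?n}"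
    show "coeff (f i) j * coeff (prod f I) (1 + ?n - j)
      = (if j = 1 then coeff (f i) 1 * coeff (prod f I) ?n else 0)"
    proof (cases "j = 0")
      case True
      then show ?thesis using IH(1) by (simp add: coeff_eq_0)
    next
      case False
      then show ?thesis using deg by (auto simp: coeff_eq_0)
    qed
  qed simp
  also have "\<dots> = coeff (f i) 1 * (\<Prod>i\<in>I. coeff (f i) 1)"
    by (simp only: sum.delta finite_atMost IH(2)) simp
  finally have "coeff (prod f (insert i I)) (card (insert i I)) = (\<Prod>i\<in>insert i I. coeff (f i) 1)"
    using insert by simp
  moreover have "degree (prod f (insert i I)) \<le> card (insert i I)"
    using degree_mult_le[of "f i" "prod f I"] IH(1) deg insert.hyps by simp
  ultimately show ?case by blast
qed simp

lemma coeff_det_linear: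
  fixes M :: "'a::comm_ring_1 poly mat"
  assumes "M \<in> carrier_mat n n"
    and "\<And>i j. i < n \<Longrightarrow> j < n \<Longrightarrow> degree (M $$ (i, j)) \<le> 1"
  shows "coeff (det M) n = det (map_mat (\<lambda>p. coeff p 1) M)"
proof -
  have summand: "coeff (signof p * (\<Prod>i = 0..<n. M $$ (i, p i))) n
      = signof p * (\<Prod>i = 0..<n. map_mat (\<lambda>p. coeff p 1) M $$ (i, p i))"
    if p: "p permutes {0..<n}" for p
  proof -
    have "p i < n" if "i < n" for i
      using permutes_in_image[OF p, of i] that by simp
    then have "coeff (\<Prod>i = 0..<n. M $$ (i, p i)) n
        = (\<Prod>i = 0..<n. map_mat (\<lambda>p. coeff p 1) M $$ (i, p i))"
      using coeff_prod_linear[of "{0..<n}" "\<lambda>i. M $$ (i, p i)"] assms by simp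
    then show ?thesis by (simp add: sign_def)
  qed
  have car: "map_mat (\<lambda>p. coeff p 1) M \<in> carrier_mat n n" using assms(1) by simp
  show ?thesis
    unfolding det_def'[OF assms(1)] det_def'[OF car] coeff_sum
    by (intro sum.cong refl summand) simp
qed

lemma col_det_zero:
  fixes vs :: "(nat \<Rightarrow> 'a::comm_ring_1) list"
  assumes "length vs = m" and "(\<lambda>_. 0) \<in> set vs"
  shows "col_det m vs = 0"
proof -
  obtain us ws where "vs = us @ (\<lambda>_. 0) # ws" using split_list[OF assms(2)] by blast
  then show ?thesis using col_det_expand[of us ws m "\<lambda>_. 0"] assms(1) by simp
qed

lemma alt_sum_filter:
  assumes "\<And>vs. length vs = k \<Longrightarrow> z \<in> set vs \<Longrightarrow> \<Phi> vs = 0"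
  shows "alt_sum \<Phi> b k cs = alt_sum \<Phi> b k (filter (\<lambda>c. snd c \<noteq> z) cs)"
  using assms
proof (induction cs arbitrary: \<Phi> b k)
  case Nil
  then show ?case by simp
next
  case (Cons c cs)
  obtain t v where c: "c = (t, v)" by (cases c)
  show ?case
  proof (cases k)
    case (Suc k')
    have keep: "alt_sum \<Phi> b k cs = alt_sum \<Phi> b k (filter (\<lambda>c. snd c \<noteq> z) cs)"
      by (rule Cons.IH) (rule Cons.prems)
    have append: "alt_sum (\<lambda>vs. \<Phi> (vs @ [v])) (\<not> b) k' cs
        = alt_sum (\<lambda>vs. \<Phi> (vs @ [v])) (\<not> b) k' (filter (\<lambda>c. snd c \<noteq> z) cs)"
      by (rule Cons.IH) (use Cons.prems Suc in auto)
    have "alt_sum (\<lambda>vs. \<Phi> (vs @ [v])) (\<not> b) k' cs = alt_sum (\<lambda>_. 0) (\<not> b) k' cs" if "v = z"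
      by (rule alt_sum_cong) (use Cons.prems Suc that in auto)
    then show ?thesis using keep append Suc by (auto simp: c)
  qed simp
qed

lemma monic_cancel:
  fixes p :: "'a::comm_ring_1 poly"
  assumes "degree p \<le> n" "coeff p n = 1" "p * x = p * y"
  shows "x = y"
proof (rule ccontr)
  assume "x \<noteq> y"
  then have nz: "lead_coeff (x - y) \<noteq> 0" by (simp only: leading_coeff_0_iff) simp
  have "degree p = n" using assms(1) le_degree[of p n] assms(2) by simp
  then have "coeff (p * (x - y)) (n + degree (x - y)) = lead_coeff (x - y)"
    using coeff_mult_degree_sum[of p "x - y"] assms(2) by simp
  moreover have "p * (x - y) = 0" using assms(3) by (simp add: algebra_simps)
  ultimately show False using nz by simp
qed

text \<open>
With the columns of \<open>z I\<close> put in front, an alternating sum becomes a monic polynomial in \<open>z\<close> of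
degree \<open>m\<close>: its coefficient at \<open>z\<^sup>m\<close> is the alternating sum for the entrywise linear
coefficients, in which the original columns vanish and the scalar case for \<open>s = 1\<close> is left.
\<close>

lemma alt_sum_monic:
  fixes cs :: "(bool \<times> (nat \<Rightarrow> 'a::comm_ring_1)) list" and m :: nat
  defines "cs' \<equiv> map (apsnd (\<lambda>v i. [:v i:])) cs @ unit_cols [:0, 1:] m"
  shows "degree (alt_sum (col_det m) b m cs') \<le> m"
    and "coeff (alt_sum (col_det m) b m cs') m = 1"
proof -
  have "snd ` set cs' = (\<lambda>v i. [:v i:]) ` snd ` set cs \<union> unit_col [:0, 1:] ` {..<m}"
    by (simp add: cs'_def image_Un image_image unit_cols_image)
  then have "degree (v i) \<le> 1" if "v \<in> snd ` set cs'" for v i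
    using that by (auto simp: unit_col_def)
  then have linear: "degree ((vs ! j) i) \<le> 1" if "set vs \<subseteq> snd ` set cs'" "j < length vs" for vs i j
    using that nth_mem by blast
  have "degree (col_det m vs) \<le> m" if "length vs = m" "set vs \<subseteq> snd ` set cs'" for vs
    using degree_det_le[of m "mat m m (\<lambda>(i, j). (vs ! j) i)" 1] linear[of vs] that
    by (simp add: col_det_def)
  then have "coeff (col_det m vs) l = 0" if "l > m" "length vs = m" "set vs \<subseteq> snd ` set cs'" for vs l
    using that le_degree by fastforce
  moreover have coeff_alt_sum: "coeff (alt_sum (col_det m) b m cs') l = alt_sum (\<lambda>vs. coeff (col_det m vs) l) b m cs'" for l
    by (rule alt_sum_additive_image) auto
  ultimately have "coeff (alt_sum (col_det m) b m cs') l = alt_sum (\<lambda>_. 0) b m cs'" if "l > m" for l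
    unfolding coeff_alt_sum using that by (intro alt_sum_cong)
  then show "degree (alt_sum (col_det m) b m cs') \<le> m"
    by (intro degree_le) simp
  let ?g = "\<lambda>v i. coeff (v i) 1"
  have "coeff (col_det m vs) m = col_det m (map ?g vs)" if "length vs = m" "set vs \<subseteq> snd ` set cs'" for vs
  proof -
    have "coeff (col_det m vs) m = det (map_mat (\<lambda>p. coeff p 1) (mat m m (\<lambda>(i, j). (vs ! j) i)))"
      unfolding col_det_def by (rule coeff_det_linear) (use linear[of vs] that in auto)
    also have "\<dots> = col_det m (map ?g vs)"
      unfolding col_det_def by (intro arg_cong[of _ _ det] eq_matI) (use that in auto)
    finally show ?thesis .
  qed
  then have "coeff (alt_sum (col_det m) b m cs') m = alt_sum (\<lambda>vs. col_det m (map ?g vs)) b m cs'"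
    unfolding coeff_alt_sum by (rule alt_sum_cong)
  also have "\<dots> = alt_sum (col_det m) b m (map (apsnd ?g) cs')"
    by (simp add: alt_sum_map)
  also have "\<dots> = alt_sum (col_det m) b m (filter (\<lambda>c. snd c \<noteq> (\<lambda>_. 0)) (map (apsnd ?g) cs'))"
    by (rule alt_sum_filter) (simp add: col_det_zero)
  also have "filter (\<lambda>c. snd c \<noteq> (\<lambda>_. 0)) (map (apsnd ?g) cs')
      = filter (\<lambda>c. snd c \<noteq> (\<lambda>_. 0)) (unit_cols 1 m)"
  proof -
    have "map (apsnd ?g) (unit_cols [:0, 1 :: 'a:] m) = unit_cols 1 m"
      by (induction m) (auto simp: unit_col_def)
    then show ?thesis by (auto simp: cs'_def filter_empty_conv)
  qed
  also have "alt_sum (col_det m) b m \<dots> = alt_sum (col_det m) b m (unit_cols 1 m)"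
    by (rule alt_sum_filter[symmetric]) (simp add: col_det_zero)
  finally show "coeff (alt_sum (col_det m) b m cs') m = 1"
    by (simp add: alt_sum_unit_cols_full)
qed

text \<open>
In \<open>R[z]\<close> the induction over the columns can start at the scalar case \<open>A = B = z I\<close>, and each step
may cancel the alternating sum because it is monic.
\<close>

lemma pair_det_factors_generic:
  fixes cs :: "(bool \<times> (nat \<Rightarrow> 'a::comm_ring_1)) list"
  assumes "m > 0"
  defines "shift \<equiv> \<lambda>cs. map (apsnd (\<lambda>v i. [:v i:])) cs @ unit_cols [:0, 1 :: 'a:] m"
  shows "pair_det m (shift cs) = alt_sum (col_det m) True m (shift cs) * alt_sum (col_det m) False m (shift cs)"
proof (induction cs)
  case Nil
  show ?case by (simp add: shift_def pair_det_unit_cols alt_sum_unit_cols_full)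
next
  case (Cons c cs)
  obtain t v where c: "c = (t, v)" by (cases c)
  have shift: "shift (c # cs) = (t, \<lambda>i. [:v i:]) # shift cs" by (simp add: shift_def c)
  show ?case unfolding shift
  proof (rule pair_det_factors_Cons[OF assms(1) _ Cons.IH])
    show "x = y" if "alt_sum (col_det m) t m (shift cs) * x = alt_sum (col_det m) t m (shift cs) * y" for x y
      using alt_sum_monic[of m t cs] that unfolding shift_def by (rule monic_cancel)
  qed
qed

section \<open>Specialisation\<close>

context comm_ring_hom begin

lemma hom_type_sum: "hom (type_sum b cs i) = type_sum b (map (apsnd (\<lambda>v i. hom (v i))) cs) i"
  by (induction cs) (auto simp: hom_add)

lemma hom_pair_form: "hom (pair_form cs i j) = pair_form (map (apsnd (\<lambda>v i. hom (v i))) cs) i j"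
  by (induction cs) (auto simp: hom_add hom_mult hom_uminus hom_type_sum)

lemma hom_pair_det: "hom (pair_det m cs) = pair_det m (map (apsnd (\<lambda>v i. hom (v i))) cs)"
  unfolding pair_det_def hom_det[symmetric]
  by (intro arg_cong[of _ _ det] eq_matI) (auto simp: hom_pair_form)

lemma hom_alt_sum:
  "hom (alt_sum (col_det m) b m cs) = alt_sum (col_det m) b m (map (apsnd (\<lambda>v i. hom (v i))) cs)"
proof -
  have "hom (col_det m vs) = col_det m (map (\<lambda>v i. hom (v i)) vs)" if "length vs = m" for vs
    unfolding col_det_def hom_det[symmetric]
    by (intro arg_cong[of _ _ det] eq_matI) (use that in auto)
  then show ?thesis
    unfolding alt_sum_map
    by (subst alt_sum_additive_image[where h = hom]) (auto simp: hom_add intro: alt_sum_cong)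
qed

end

lemma pair_form_append_unit_cols_0: "pair_form (cs @ unit_cols 0 m) i j = pair_form cs i j"
proof -
  have "type_sum b (cs @ unit_cols 0 m) i = type_sum b cs i" for b
    by (induction cs) (auto simp: type_sum_unit_cols)
  then show ?thesis
    by (induction cs) (auto simp: pair_form_unit_cols)
qed

text \<open>
Setting \<open>z = 0\<close> turns the auxiliary columns into zero columns, which contribute nothing.
\<close>

theorem pair_det_factors:
  assumes "m > 0"
  shows "pair_det m cs = alt_sum (col_det m) True m cs * alt_sum (col_det m) False m cs"
proof -
  interpret at_0: comm_ring_hom "\<lambda>p::'a poly. poly p 0"
    by unfold_locales auto
  let ?Z = "unit_cols (0::'a) m"
  let ?cs' = "map (apsnd (\<lambda>v i. [:v i:])) cs @ unit_cols [:0, 1 :: 'a:] m"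
  have "map (apsnd (\<lambda>v i. poly (v i) 0)) (unit_cols [:0, 1 :: 'a:] m) = ?Z"
    by (induction m) (auto simp: unit_col_def)
  moreover have "map (apsnd (\<lambda>v i. poly (v i) 0)) (map (apsnd (\<lambda>v i. [:v i:])) cs) = cs"
    by (induction cs) auto
  ultimately have at_0: "map (apsnd (\<lambda>v i. poly (v i) 0)) ?cs' = cs @ ?Z"
    by (simp only: map_append)
  have "alt_sum (col_det m) b m (cs @ ?Z) = alt_sum (col_det m) b m cs" for b
  proof -
    have "snd c = (\<lambda>_. 0)" if "c \<in> set ?Z" for c
      using that by (induction m) (auto simp: unit_col_def)
    then have "filter (\<lambda>c. snd c \<noteq> (\<lambda>_. 0)) (cs @ ?Z) = filter (\<lambda>c. snd c \<noteq> (\<lambda>_. 0)) cs"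
      by (auto simp: filter_empty_conv)
    then show ?thesis
      using alt_sum_filter[of m "\<lambda>_. 0" "col_det m" b] col_det_zero by metis
  qed
  moreover have "pair_det m (cs @ ?Z) = pair_det m cs"
    by (simp add: pair_det_def pair_form_append_unit_cols_0)
  moreover have "pair_det m (cs @ ?Z)
      = alt_sum (col_det m) True m (cs @ ?Z) * alt_sum (col_det m) False m (cs @ ?Z)"
    using arg_cong[OF pair_det_factors_generic[OF assms, of cs], of "\<lambda>p. poly p 0"]
    by (simp only: at_0.hom_mult at_0.hom_pair_det at_0.hom_alt_sum at_0)
  ultimately show ?thesis by simp
qed

section \<open>Index chains as alternating subsequences\<close>

text \<open>
The two families of index chains, told apart by the parity \<open>b\<close> of the positions of \<open>A\<close>: for
\<open>b = True\<close> a chain starts with an index of \<open>A\<close>, for \<open>b = False\<close> with one of \<open>B\<close>. A step out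
of an \<open>A\<close>-position is weak and one out of a \<open>B\<close>-position strict, because \<open>A\<close> comes directly
before \<open>B\<close> in the interleaved order.
\<close>

definition alt_chains :: "bool \<Rightarrow> nat \<Rightarrow> nat \<Rightarrow> nat list set" where
  "alt_chains b m n = {c. length c = m \<and> set c \<subseteq> {..<n} \<and>
     (\<forall>k. Suc k < m \<longrightarrow> (if even k = b then c ! k \<le> c ! Suc k else c ! k < c ! Suc k))}"

definition alt_pick :: "bool \<Rightarrow> (nat \<Rightarrow> 'v) \<Rightarrow> (nat \<Rightarrow> 'v) \<Rightarrow> nat list \<Rightarrow> 'v list" where
  "alt_pick b A B c = map (\<lambda>k. if even k = b then A (c ! k) else B (c ! k)) [0..<length c]"

fun interleave :: "(nat \<Rightarrow> 'v) \<Rightarrow> (nat \<Rightarrow> 'v) \<Rightarrow> nat \<Rightarrow> (bool \<times> 'v) list" where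
  "interleave A B 0 = []"
| "interleave A B (Suc n) = (False, B n) # (True, A n) # interleave A B n"

lemma finite_alt_chains: "finite (alt_chains b m n)"
  by (rule finite_subset[OF _ finite_lists_length_eq[of "{..<n}" m]]) (auto simp: alt_chains_def)

lemma alt_chains_0: "alt_chains b 0 n = {[]}"
  by (auto simp: alt_chains_def)

lemma alt_chains_no_index: "alt_chains b (Suc k) 0 = {}"
  by (auto simp: alt_chains_def)

lemma alt_chains_sorted: "c \<in> alt_chains b m n \<Longrightarrow> sorted c"
  by (auto simp: alt_chains_def sorted_iff_nth_Suc split: if_splits)

lemma alt_chains_snoc:
  "c @ [x] \<in> alt_chains b (Suc k) n \<longleftrightarrow>
     c \<in> alt_chains b k (if even k = b then x else Suc x) \<and> x < n"
proof
  assume L: "c @ [x] \<in> alt_chains b (Suc k) n"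
  then have len: "length c = k" and n: "set c \<subseteq> {..<n}" "x < n"
    and steps: "\<And>i. Suc i < Suc k \<Longrightarrow> if even i = b then (c @ [x]) ! i \<le> (c @ [x]) ! Suc i
      else (c @ [x]) ! i < (c @ [x]) ! Suc i"
    by (auto simp: alt_chains_def)
  have steps': "if even i = b then c ! i \<le> c ! Suc i else c ! i < c ! Suc i" if "Suc i < k" for i
    using steps[of i] that len by (simp add: nth_append split: if_splits)
  have sorted: "sorted (c @ [x])" using alt_chains_sorted[OF L] .
  have "y < (if even k = b then x else Suc x)" if y: "y \<in> set c" for y
  proof (cases k)
    case 0
    then show ?thesis using len y by simp
  next
    case (Suc k')
    obtain i where i: "i < k" "y = c ! i" using y len in_set_conv_nth[of y c] by auto
    have "sorted c" using sorted by (simp add: sorted_append)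
    then have "y \<le> c ! k'" using i Suc len by (simp add: sorted_nth_mono)
    moreover have "if even k' = b then c ! k' \<le> x else c ! k' < x"
      using steps[of k'] Suc len by (simp add: nth_append split: if_splits)
    ultimately show ?thesis using Suc by (auto split: if_splits)
  qed
  then show "c \<in> alt_chains b k (if even k = b then x else Suc x) \<and> x < n"
    using len steps' n by (auto simp: alt_chains_def)
next
  assume R: "c \<in> alt_chains b k (if even k = b then x else Suc x) \<and> x < n"
  then have len: "length c = k" and c: "\<And>y. y \<in> set c \<Longrightarrow> y < (if even k = b then x else Suc x)"
    and steps: "\<And>i. Suc i < k \<Longrightarrow> if even i = b then c ! i \<le> c ! Suc i else c ! i < c ! Suc i"
    by (auto simp: alt_chains_def)
  have "if even i = b then (c @ [x]) ! i \<le> (c @ [x]) ! Suc i else (c @ [x]) ! i < (c @ [x]) ! Suc i"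
    if "Suc i < Suc k" for i
  proof (cases "Suc i = k")
    case True
    then have "c ! i < (if even k = b then x else Suc x)" using c len by simp
    then show ?thesis using True len by (auto simp: nth_append split: if_splits)
  next
    case False
    then show ?thesis using steps[of i] that len by (simp add: nth_append)
  qed
  moreover have "y < n" if "y \<in> set c" for y
    using c[OF that] R by (auto split: if_splits)
  ultimately show "c @ [x] \<in> alt_chains b (Suc k) n"
    using R len by (auto simp: alt_chains_def subset_iff)
qed

lemma alt_chains_Suc:
  "alt_chains b (Suc k) (Suc n) = alt_chains b (Suc k) n
     \<union> (\<lambda>c. c @ [n]) ` alt_chains b k (if even k = b then n else Suc n)"
proof (rule Set.set_eqI)
  fix c :: "nat list"
  show "c \<in> alt_chains b (Suc k) (Suc n) \<longleftrightarrow> c \<in> alt_chains b (Suc k) n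
     \<union> (\<lambda>c. c @ [n]) ` alt_chains b k (if even k = b then n else Suc n)"
  proof (cases c rule: rev_cases)
    case Nil
    then show ?thesis by (auto simp: alt_chains_def)
  next
    case (snoc d x)
    then show ?thesis by (auto simp: alt_chains_snoc less_Suc_eq)
  qed
qed

text \<open>
The largest index of a chain is its last one. Chains that use the new index \<open>n\<close> correspond to
alternating subsequences whose last term is the new column of \<open>A\<close> or of \<open>B\<close>; in the latter case
the new column of \<open>A\<close> may still precede it, whence the two ranges for the rest of the chain.
\<close>

lemma sum_alt_chains:
  "(\<Sum>c\<in>alt_chains b k n. \<Phi> (alt_pick b A B c)) = alt_sum \<Phi> (odd k = b) k (interleave A B n)"
proof (induction k arbitrary: \<Phi> n)
  case 0
  show ?case by (simp add: alt_chains_0 alt_pick_def)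
next
  case (Suc k)
  note IH = Suc.IH
  show ?case
  proof (induction n)
    case 0
    show ?case by (simp add: alt_chains_no_index)
  next
    case (Suc n)
    define t where "t = (even k = b)"
    let ?x = "if t then A n else B n" and ?n = "if t then n else Suc n"
    have disjoint: "alt_chains b (Suc k) n \<inter> (\<lambda>c. c @ [n]) ` alt_chains b k ?n = {}"
      by (auto simp: alt_chains_snoc)
    have pick: "alt_pick b A B (c @ [n]) = alt_pick b A B c @ [?x]" if "c \<in> alt_chains b k ?n" for c
      using that by (auto simp: alt_pick_def alt_chains_def nth_append t_def)
    have t: "(odd (Suc k) = b) = t" "(odd k = b) = (\<not> t)" by (auto simp: t_def)
    have "(\<Sum>c\<in>alt_chains b (Suc k) (Suc n). \<Phi> (alt_pick b A B c))
        = (\<Sum>c\<in>alt_chains b (Suc k) n. \<Phi> (alt_pick b A B c))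
        + (\<Sum>c\<in>alt_chains b k ?n. \<Phi> (alt_pick b A B (c @ [n])))"
      unfolding alt_chains_Suc t_def[symmetric]
      by (subst sum.union_disjoint) (simp_all add: finite_alt_chains disjoint sum.reindex inj_on_def)
    also have "(\<Sum>c\<in>alt_chains b k ?n. \<Phi> (alt_pick b A B (c @ [n])))
        = (\<Sum>c\<in>alt_chains b k ?n. \<Phi> (alt_pick b A B c @ [?x]))"
      by (rule sum.cong) (simp_all add: pick)
    also have "\<dots> = alt_sum (\<lambda>vs. \<Phi> (vs @ [?x])) (\<not> t) k (interleave A B ?n)"
      using IH[of "\<lambda>vs. \<Phi> (vs @ [?x])" ?n] unfolding t .
    finally have "(\<Sum>c\<in>alt_chains b (Suc k) (Suc n). \<Phi> (alt_pick b A B c))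
        = alt_sum \<Phi> t (Suc k) (interleave A B n)
        + alt_sum (\<lambda>vs. \<Phi> (vs @ [?x])) (\<not> t) k (interleave A B ?n)"
      unfolding Suc.IH t .
    then show ?case unfolding t by (cases k) (simp_all split: if_splits)
  qed
qed

lemma type_sum_interleave: "type_sum t (interleave A B n) i = (\<Sum>p<n. (if t then A p else B p) i)"
  by (induction n) auto

lemma pair_form_interleave:
  "pair_form (interleave A B n) i j =
     (\<Sum>q<n. (\<Sum>p<q. A p i * B q j + B p i * A q j) + A q i * B q j)"
proof (induction n)
  case (Suc n)
  have "(\<Sum>p<n. A p i * B n j + B p i * A n j) = (\<Sum>p<n. A p i) * B n j + (\<Sum>p<n. B p i) * A n j"
    by (simp only: sum.distrib sum_distrib_right)
  then show ?case using Suc by (simp add: type_sum_interleave algebra_simps)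
qed simp

lemma times_transpose_entry:
  assumes "X \<in> carrier_mat m n" "Y \<in> carrier_mat m n" "i < m" "j < m"
  shows "(X * transpose_mat Y) $$ (i, j) = (\<Sum>q<n. X $$ (i, q) * Y $$ (j, q))"
  using assms by (simp add: scalar_prod_def atLeast0LessThan)

lemma strict_upper_ones_entry:
  assumes "X \<in> carrier_mat m n" "Y \<in> carrier_mat m n" "i < m" "j < m"
  shows "(X * strict_upper_ones n * transpose_mat Y) $$ (i, j)
    = (\<Sum>q<n. \<Sum>p<q. X $$ (i, p) * Y $$ (j, q))"
proof -
  have U: "strict_upper_ones n \<in> carrier_mat n n" by (simp add: strict_upper_ones_def)
  have "(X * strict_upper_ones n) $$ (i, q) = (\<Sum>p<q. X $$ (i, p))" if "q < n" for q
  proof -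
    have "(X * strict_upper_ones n) $$ (i, q) = (\<Sum>p<n. X $$ (i, p) * (if p < q then 1 else 0))"
      using assms that by (simp add: strict_upper_ones_def scalar_prod_def atLeast0LessThan)
    also have "\<dots> = (\<Sum>p<q. X $$ (i, p))"
      by (rule sum.mono_neutral_cong_right) (use that in auto)
    finally show ?thesis .
  qed
  then show ?thesis
    using times_transpose_entry[OF mult_carrier_mat[OF assms(1) U] assms(2-4)]
    by (simp add: sum_distrib_right)
qed

section \<open>Factorisation of the determinant\<close>

theorem theorem17:
  fixes A B :: "'a::comm_ring_1 mat" and m n :: nat
  assumes "m > 0" and "n > 0"
    and "A \<in> carrier_mat m n" and "B \<in> carrier_mat m n"
  shows "det (A * strict_upper_ones n * transpose_mat B
            + B * strict_upper_ones n * transpose_mat A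
            + A * transpose_mat B)
       = (\<Sum>c\<in>weak_strict_chains m n. det (alternating_cols A B c))
       * (\<Sum>c\<in>strict_weak_chains m n. det (alternating_cols B A c))"
proof -
  let ?A = "\<lambda>q i. A $$ (i, q)" and ?B = "\<lambda>q i. B $$ (i, q)"
  let ?cs = "interleave ?A ?B n"
  have "A * strict_upper_ones n * transpose_mat B + B * strict_upper_ones n * transpose_mat A
      + A * transpose_mat B = mat m m (\<lambda>(i, j). pair_form ?cs i j)"
  proof (rule eq_matI)
    fix i j assume "i < dim_row (mat m m (\<lambda>(i, j). pair_form ?cs i j))"
      "j < dim_col (mat m m (\<lambda>(i, j). pair_form ?cs i j))"
    then have ij: "i < m" "j < m" by auto
    then show "(A * strict_upper_ones n * transpose_mat B
        + B * strict_upper_ones n * transpose_mat A + A * transpose_mat B) $$ (i, j)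
        = mat m m (\<lambda>(i, j). pair_form ?cs i j) $$ (i, j)"
      using assms times_transpose_entry[of A m n B i j] strict_upper_ones_entry[of A m n B i j] strict_upper_ones_entry[of B m n A i j]
      by (simp add: pair_form_interleave sum.distrib strict_upper_ones_def del: index_mult_mat(1))
  qed (use assms in auto)
  then have "det (A * strict_upper_ones n * transpose_mat B
        + B * strict_upper_ones n * transpose_mat A + A * transpose_mat B) = pair_det m ?cs"
    by (simp only: pair_det_def)
  moreover have "(\<Sum>c\<in>weak_strict_chains m n. det (alternating_cols A B c))
      = alt_sum (col_det m) (odd m) m ?cs"
  proof -
    have "det (alternating_cols A B c) = col_det m (alt_pick True ?A ?B c)"
      if "c \<in> alt_chains True m n" for c
      unfolding alternating_cols_def col_det_def
      by (intro arg_cong[of _ _ det] eq_matI)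
        (use that assms in \<open>auto simp: alt_chains_def alt_pick_def mat_of_cols_def subset_iff\<close>)
    then show ?thesis
      using sum_alt_chains[of "col_det m" True ?A ?B m n]
      by (simp add: weak_strict_chains_def alt_chains_def)
  qed
  moreover have "(\<Sum>c\<in>strict_weak_chains m n. det (alternating_cols B A c))
      = alt_sum (col_det m) (even m) m ?cs"
  proof -
    have "strict_weak_chains m n = alt_chains False m n"
      by (auto simp: strict_weak_chains_def alt_chains_def split: if_splits)
    moreover have "det (alternating_cols B A c) = col_det m (alt_pick False ?A ?B c)"
      if "c \<in> alt_chains False m n" for c
      unfolding alternating_cols_def col_det_def
      by (intro arg_cong[of _ _ det] eq_matI)
        (use that assms in \<open>auto simp: alt_chains_def alt_pick_def mat_of_cols_def subset_iff\<close>)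
    ultimately show ?thesis
      using sum_alt_chains[of "col_det m" False ?A ?B m n] by simp
  qed
  ultimately show ?thesis
    using pair_det_factors[OF assms(1), of ?cs] by (cases "even m") (simp_all add: mult.commute)
qed

end
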